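(* Let $\mathcal{A}$ be any classification rule and let $1\leq p\leq n-1$ be such that the quantities below are well defined. Put $m=n-p+1$. Then the leave-$p$-out estimator $$\widehat{R}_{p,n}=\widehat{R}_p(\mathcal{A},\mathcal{D}_n)=\binom{n}{p}^{-1}\sum_{e\in\mathcal{E}_{n-p}}\Big(\frac1p\sum_{i\in\bar e}\mathbf{1}_{\{\mathcal{A}^{\mathcal{D}^e}(X_i)\neq Y_i\}}\Big)$$ is a U-statistic of order $m=n-p+1$ in $Z_1,\ldots,Z_n$, with kernel $h_m:(\mathcal{X}\times\{0,1\})^m\to\mathbb{R}$ defined by $$h_m(Z_1,\ldots,Z_m)=\frac1m\sum_{i=1}^m\mathbf{1}_{\{\mathcal{A}^{\mathcal{D}_m^{(i)}}(X_i)\neq Y_i\}},$$ where $\mathcal{D}_m^{(i)}$ denotes the sample $\mathcal{D}_m=(Z_1,\ldots,Z_m)$ with $Z_i$ withdrawn.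
   Context: Let $\mathcal{X}\subset\mathbb{R}^d$ and let $\mathcal{D}_n=\{Z_1,\ldots,Z_n\}$, $Z_i=(X_i,Y_i)\in\mathcal{X}\times\{0,1\}$, be i.i.d. copies of a pair $(X,Y)$ with arbitrary distribution. A classification rule $\mathcal{A}$ is a (deterministic) map sending each training sample $\mathcal{D}$ (a finite collection of elements of $\mathcal{X}\times\{0,1\}$, the order of the elements being irrelevant) to a measurable classifier $\mathcal{A}^{\mathcal{D}}:\mathcal{X}\to\{0,1\}$. $\mathcal{E}_{n-p}$ is the set of all subsets of $\{1,\ldots,n\}$ with cardinality $n-p$; for $e\in\mathcal{E}_{n-p}$, $\bar e=\{1,\ldots,n\}\setminus e$ and $\mathcal{D}^e=\{Z_i\mid i\in e\}$. A U-statistic of order $m\leq n$ with kernel $h$ (a Borel function of $m$ arguments, symmetric in its arguments) is the function $U_n(x_1,\ldots,x_n)=\binom nm^{-1}\sum_{1\leq i_1<\cdots<i_m\leq n}h(x_{i_1},\ldots,x_{i_m})$. *)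

theory Defs
  imports "HOL-Probability.Probability"
begin

section \<open>U-statistics\<close>

text \<open>
  A function of \<open>m\<close> arguments is represented by its values on lists of length \<open>m\<close>; its Borel
  measurability is measurability with respect to the \<open>m\<close>-fold product sigma-algebra, whose
  coordinates are indexed by \<open>1, \<dots>, m\<close>.
\<close>

definition U_kernel :: "'z measure \<Rightarrow> nat \<Rightarrow> ('z list \<Rightarrow> real) \<Rightarrow> bool" where
  "U_kernel S m h \<longleftrightarrow>
     (\<lambda>x. h (map x [1..<Suc m])) \<in> borel_measurable (PiM {1..m} (\<lambda>_. S)) \<and>
     (\<forall>zs zs'. set zs \<subseteq> space S \<and> length zs = m \<and> mset zs' = mset zs \<longrightarrow> h zs' = h zs)"

text \<open>The list \<open>js\<close> below is an index sequence \<open>1 \<le> i\<^sub>1 < \<dots> < i\<^sub>m \<le> n\<close>.\<close>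

definition U_stat :: "nat \<Rightarrow> nat \<Rightarrow> ('z list \<Rightarrow> real) \<Rightarrow> (nat \<Rightarrow> 'z) \<Rightarrow> real" where
  "U_stat n m h x =
     (\<Sum>js | length js = m \<and> sorted_wrt (<) js \<and> set js \<subseteq> {1..n}. h (map x js)) / real (n choose m)"

definition is_U_statistic ::
    "'z measure \<Rightarrow> nat \<Rightarrow> nat \<Rightarrow> ('z list \<Rightarrow> real) \<Rightarrow> ((nat \<Rightarrow> 'z) \<Rightarrow> real) \<Rightarrow> bool" where
  "is_U_statistic S n m h T \<longleftrightarrow>
     m \<le> n \<and> U_kernel S m h \<and> (\<forall>x \<in> {1..n} \<rightarrow> space S. T x = U_stat n m h x)"

section \<open>Classification rules and the leave-p-out estimator\<close>

text \<open>The labels 0 and 1 are the Booleans.\<close>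

definition obs_space :: "(real ^ 'd) set \<Rightarrow> ((real ^ 'd) \<times> bool) measure" where
  "obs_space X = restrict_space borel X \<Otimes>\<^sub>M count_space UNIV"

text \<open>
  Training samples are multisets: the order of the observations is irrelevant, but repeated
  observations count.
\<close>

definition classification_rule ::
    "(real ^ 'd) set \<Rightarrow> (((real ^ 'd) \<times> bool) multiset \<Rightarrow> real ^ 'd \<Rightarrow> bool) \<Rightarrow> bool" where
  "classification_rule X A \<longleftrightarrow>
     (\<forall>D. set_mset D \<subseteq> X \<times> UNIV \<longrightarrow> A D \<in> measurable (restrict_space borel X) (count_space UNIV))"

definition subsample :: "(nat \<Rightarrow> 'z) \<Rightarrow> nat set \<Rightarrow> 'z multiset" where
  "subsample z e = image_mset z (mset_set e)"

definition loss :: "('z multiset \<Rightarrow> 'x \<Rightarrow> bool) \<Rightarrow> 'z multiset \<Rightarrow> 'x \<times> bool \<Rightarrow> real" where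
  "loss A D w = of_bool (A D (fst w) \<noteq> snd w)"

definition lpo_risk ::
    "(('x \<times> bool) multiset \<Rightarrow> 'x \<Rightarrow> bool) \<Rightarrow> nat \<Rightarrow> nat \<Rightarrow> (nat \<Rightarrow> 'x \<times> bool) \<Rightarrow> real" where
  "lpo_risk A p n z =
     (\<Sum>e | e \<subseteq> {1..n} \<and> card e = n - p.
        (1 / real p) * (\<Sum>i \<in> {1..n} - e. loss A (subsample z e) (z i))) / real (n choose p)"

text \<open>The multiset difference withdraws a single occurrence of the value of the \<open>i\<close>-th observation.\<close>

definition lpo_kernel ::
    "(('x \<times> bool) multiset \<Rightarrow> 'x \<Rightarrow> bool) \<Rightarrow> nat \<Rightarrow> ('x \<times> bool) list \<Rightarrow> real" where
  "lpo_kernel A m zs = (1 / real m) * (\<Sum>i<m. loss A (mset zs - {#zs ! i#}) (zs ! i))"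

text \<open>
  Measurability of each classifier \<open>A D\<close> alone does not make the estimator a Borel function of the
  sample, hence a random variable; this is the requirement that the estimator be well defined.
\<close>

definition lpo_well_defined ::
    "(real ^ 'd) set \<Rightarrow> (((real ^ 'd) \<times> bool) multiset \<Rightarrow> real ^ 'd \<Rightarrow> bool) \<Rightarrow> nat \<Rightarrow> nat \<Rightarrow> bool" where
  "lpo_well_defined X A p n \<longleftrightarrow>
     lpo_risk A p n \<in> borel_measurable (PiM {1..n} (\<lambda>_. obs_space X))"

definition iid_sample ::
    "'w measure \<Rightarrow> 'z measure \<Rightarrow> 'z measure \<Rightarrow> nat \<Rightarrow> (nat \<Rightarrow> 'w \<Rightarrow> 'z) \<Rightarrow> bool" where
  "iid_sample P S Q n Z \<longleftrightarrow>
     prob_space P \<and> prob_space.indep_vars P (\<lambda>_. S) Z {1..n} \<and> (\<forall>i \<in> {1..n}. distr P S (Z i) = Q)"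

end

theory Submission
  imports Defs
begin

text \<open>
  The identity is double counting: a pair of a training set \<open>e\<close> of size \<open>n - p\<close> and a test index
  \<open>i \<notin> e\<close> is the same as the set \<open>insert i e\<close> of size \<open>m\<close> with a marked element.

  The measurability of the kernel has to be recovered from that of the estimator alone. Evaluate the
  U-statistic at \<open>n\<close>-tuples in which one variable \<open>x\<close> is repeated: the tuple made of a multiset \<open>W\<close>
  of \<open>j \<le> m\<close> further variables and \<open>n - j\<close> copies of \<open>x\<close> yields a positive multiple of the kernel at
  \<open>W\<close> and \<open>m - j\<close> copies of \<open>x\<close>, plus kernel values with more than \<open>m - j\<close> copies of \<open>x\<close>.
  By induction on \<open>j\<close>, each kernel value is a linear combination of measurable functions.
\<close>

lemma sum_strict_sorted_lists:
  fixes g :: "nat set \<Rightarrow> 'b::comm_monoid_add"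
  shows "(\<Sum>js | length js = m \<and> sorted_wrt (<) js \<and> set js \<subseteq> {1..n}. g (set js)) =
         (\<Sum>J | J \<subseteq> {1..n} \<and> card J = m. g J)"
proof (rule sum.reindex_bij_witness[where i = sorted_list_of_set and j = set])
  fix js :: "nat list"
  assume "js \<in> {js. length js = m \<and> sorted_wrt (<) js \<and> set js \<subseteq> {1..n}}"
  then have js: "length js = m" "sorted_wrt (<) js" "set js \<subseteq> {1..n}" by auto
  then have "distinct js" "sorted js" by (auto simp: strict_sorted_iff)
  then show "sorted_list_of_set (set js) = js"
    by (simp add: sorted_list_of_set.idem_if_sorted_distinct)
  show "set js \<in> {J. J \<subseteq> {1..n} \<and> card J = m}"
    using js \<open>distinct js\<close> by (simp add: distinct_card)
next
  fix J :: "nat set"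
  assume J: "J \<in> {J. J \<subseteq> {1..n} \<and> card J = m}"
  then have "finite J" by (auto intro: finite_subset)
  with J show "set (sorted_list_of_set J) = J"
    "sorted_list_of_set J \<in> {js. length js = m \<and> sorted_wrt (<) js \<and> set js \<subseteq> {1..n}}"
    by auto
qed auto

text \<open>A kernel that sees only the multiset of its arguments cannot distinguish an increasing
  index list from the index set it enumerates.\<close>

lemma U_stat_eq_sum_subsets:
  assumes "\<And>zs. length zs = m \<Longrightarrow> h zs = H (mset zs)"
  shows "U_stat n m h z =
    (\<Sum>J | J \<subseteq> {1..n} \<and> card J = m. H (subsample z J)) / real (n choose m)"
proof -
  have "(\<Sum>js | length js = m \<and> sorted_wrt (<) js \<and> set js \<subseteq> {1..n}. h (map z js)) =
        (\<Sum>js | length js = m \<and> sorted_wrt (<) js \<and> set js \<subseteq> {1..n}. H (subsample z (set js)))"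
    by (intro sum.cong refl)
      (auto simp: assms subsample_def mset_set_set strict_sorted_iff)
  then show ?thesis
    using sum_strict_sorted_lists[of "\<lambda>J. H (subsample z J)" m n] by (simp add: U_stat_def)
qed

lemma sum_marked_subsets:
  fixes f :: "'a set \<Rightarrow> 'a \<Rightarrow> 'b::comm_monoid_add"
  assumes "finite B"
  shows "(\<Sum>e | e \<subseteq> B \<and> card e = k. \<Sum>i \<in> B - e. f e i) =
         (\<Sum>J | J \<subseteq> B \<and> card J = Suc k. \<Sum>i \<in> J. f (J - {i}) i)"
proof -
  have fin: "finite J" if "J \<subseteq> B" for J
    using assms that by (rule rev_finite_subset)
  have finite_levels: "finite {J. J \<subseteq> B \<and> card J = l}" for l
    using assms by simp
  have "(\<Sum>e | e \<subseteq> B \<and> card e = k. \<Sum>i \<in> B - e. f e i) =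
        (\<Sum>(e, i) \<in> Sigma {e. e \<subseteq> B \<and> card e = k} (\<lambda>e. B - e). f e i)"
    using assms finite_levels by (intro sum.Sigma) auto
  also have "\<dots> = (\<Sum>(J, i) \<in> Sigma {J. J \<subseteq> B \<and> card J = Suc k} (\<lambda>J. J). f (J - {i}) i)"
  proof (rule sum.reindex_bij_witness
      [where i = "\<lambda>(J, i). (J - {i}, i)" and j = "\<lambda>(e, i). (insert i e, i)"], goal_cases)
    case (1 a)
    then show ?case by (cases a) auto
  next
    case (2 a)
    then show ?case using fin by (cases a) (auto simp: card_insert_disjoint)
  next
    case (3 b)
    then show ?case by (cases b) auto
  next
    case (4 b)
    then show ?case using fin by (cases b) (auto simp: card_Diff_singleton)
  next
    case (5 a)
    then have "insert (snd a) (fst a) - {snd a} = fst a" by auto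
    then show ?case by (cases a) simp
  qed
  also have "\<dots> = (\<Sum>J | J \<subseteq> B \<and> card J = Suc k. \<Sum>i \<in> J. f (J - {i}) i)"
    using fin finite_levels by (intro sum.Sigma[symmetric]) auto
  finally show ?thesis .
qed

text \<open>Working on multisets builds the symmetry in and lets arguments be repeated or
  substituted through \<open>image_mset\<close>.\<close>

definition lpo_mset_kernel ::
    "(('x \<times> bool) multiset \<Rightarrow> 'x \<Rightarrow> bool) \<Rightarrow> nat \<Rightarrow> ('x \<times> bool) multiset \<Rightarrow> real" where
  "lpo_mset_kernel A m M = (1 / real m) * (\<Sum>w\<in>#M. loss A (M - {#w#}) w)"

lemma lpo_kernel_eq_mset_kernel:
  assumes "length zs = m"
  shows "lpo_kernel A m zs = lpo_mset_kernel A m (mset zs)"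
proof -
  have "(\<Sum>w\<in>#mset zs. loss A (mset zs - {#w#}) w) =
        sum_list (map (\<lambda>w. loss A (mset zs - {#w#}) w) zs)"
    by (simp flip: sum_mset_sum_list)
  also have "\<dots> = (\<Sum>i<m. loss A (mset zs - {#zs ! i#}) (zs ! i))"
    using assms by (simp add: sum_list_sum_nth atLeast0LessThan)
  finally show ?thesis
    by (simp add: lpo_kernel_def lpo_mset_kernel_def)
qed

text \<open>Multisets record multiplicities, so removing one copy of \<open>z i\<close> amounts to
  dropping the index \<open>i\<close>, even when other indices of \<open>J\<close> carry the same
  value.\<close>

lemma lpo_mset_kernel_subsample:
  assumes "finite J"
  shows "lpo_mset_kernel A m (subsample z J) =
         (1 / real m) * (\<Sum>i \<in> J. loss A (subsample z (J - {i})) (z i))"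
proof -
  have "subsample z J - {#z i#} = subsample z (J - {i})" if "i \<in> J" for i
    using assms that
    by (simp add: subsample_def mset_set_Diff image_mset_Diff)
  then have "(\<Sum>i \<in> J. loss A (subsample z J - {#z i#}) (z i)) =
        (\<Sum>i \<in> J. loss A (subsample z (J - {i})) (z i))"
    by simp
  moreover have "(\<Sum>w\<in>#subsample z J. loss A (subsample z J - {#w#}) w) =
        (\<Sum>i \<in> J. loss A (subsample z J - {#z i#}) (z i))"
    by (simp add: subsample_def sum_unfold_sum_mset image_mset.compositionality comp_def)
  ultimately show ?thesis
    by (simp add: lpo_mset_kernel_def)
qed

text \<open>By double counting, both sides are multiples of the same marked sum \<open>T\<close>; it
  remains to compare the normalising constants.\<close>

lemma lpo_risk_eq_sum_subsets:
  assumes p: "1 \<le> p" "p \<le> n" and m: "m = n - p + 1"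
  shows "lpo_risk A p n z =
    (\<Sum>J | J \<subseteq> {1..n} \<and> card J = m. lpo_mset_kernel A m (subsample z J)) / real (n choose m)"
proof -
  define T where "T = (\<Sum>J | J \<subseteq> {1..n} \<and> card J = m.
    \<Sum>i \<in> J. loss A (subsample z (J - {i})) (z i))"
  have "lpo_risk A p n z = (1 / real p) * T / real (n choose p)"
    unfolding lpo_risk_def T_def m
    by (simp add: sum_marked_subsets flip: sum_divide_distrib)
  moreover have "(\<Sum>J | J \<subseteq> {1..n} \<and> card J = m. lpo_mset_kernel A m (subsample z J)) =
      (1 / real m) * T"
    unfolding T_def sum_distrib_left[of "1 / real m"
      "\<lambda>J. \<Sum>i \<in> J. loss A (subsample z (J - {i})) (z i)"]
    by (intro sum.cong refl lpo_mset_kernel_subsample) (auto intro: finite_subset)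
  \<comment> \<open>Both sides count the pairs of an \<open>m\<close>-subset of
    \<open>{1..n}\<close> and a marked element of it.\<close>
  moreover have "real p * real (n choose p) = real m * real (n choose m)"
  proof -
    have "p * (n choose p) = (n - (n - p)) * (n choose (n - p))"
      using p by (simp add: binomial_symmetric[of p n])
    also have "\<dots> = Suc (n - p) * (n choose Suc (n - p))"
      using p by (metis binomial_absorb_comp binomial_absorption mult.commute)
    finally have "p * (n choose p) = m * (n choose m)" using m by simp
    then show ?thesis by (metis of_nat_mult)
  qed
  ultimately show ?thesis by simp
qed

text \<open>Elements of \<open>I\<close> name variables, and \<open>M\<close> says which variables,
  with repetition, fill the arguments of the kernel. Repetition is allowed because the induction, on
  the number of entries of \<open>M\<close> other than \<open>i0\<close>, passes to multisets with
  more copies of \<open>i0\<close>.\<close>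

lemma measurable_kernel_of_measurable_U_sum:
  fixes H :: "'z multiset \<Rightarrow> real" and i0 :: 'i
  assumes U: "(\<lambda>z. \<Sum>J | J \<subseteq> {1..n} \<and> card J = m. H (subsample z J))
      \<in> borel_measurable (PiM {1..n} (\<lambda>_. S))"
    and mn: "m \<le> n" and i0: "i0 \<in> I"
    and M: "set_mset M \<subseteq> I" "size M = m"
  shows "(\<lambda>x. H (image_mset x M)) \<in> borel_measurable (PiM I (\<lambda>_. S))"
  using M
proof (induction "size (filter_mset (\<lambda>i. i \<noteq> i0) M)" arbitrary: M rule: less_induct)
  case (less M)
  obtain ms where ms: "mset ms = M" using ex_mset by blast
  then have len: "length ms = m" using less.prems by auto
  \<comment> \<open>The variables of \<open>M\<close> are padded with \<open>i0\<close> to an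
    \<open>n\<close>-tuple. Sample positions start at 1 and list positions at 0, hence the shift in
    \<open>\<sigma>\<close>.\<close>
  define xs where "xs = ms @ replicate (n - m) i0"
  define \<sigma> where "\<sigma> i = xs ! (i - 1)" for i
  define Js where "Js = {J. J \<subseteq> {1..n} \<and> card J = m}"
  have len_xs: "length xs = n" using len mn by (simp add: xs_def)
  have image_\<sigma>: "image_mset \<sigma> (mset_set {1..k}) = mset (take k xs)" if "k \<le> n" for k
  proof -
    have "map \<sigma> [1..<Suc k] = take k xs"
      using that len_xs by (intro nth_equalityI) (auto simp: \<sigma>_def simp del: upt_Suc)
    then show ?thesis
      by (metis atLeastLessThanSuc_atLeastAtMost mset_map mset_upt)
  qed
  have "set xs \<subseteq> I" using ms less.prems i0 by (auto simp: xs_def)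
  then have \<sigma>_I: "\<sigma> i \<in> I" if "i \<in> {1..n}" for i
    using that len_xs by (auto simp: \<sigma>_def intro!: subsetD[OF _ nth_mem])
  have finJs: "finite Js" by (simp add: Js_def)
  have sum_meas: "(\<lambda>x. \<Sum>J\<in>Js. H (image_mset x (image_mset \<sigma> (mset_set J))))
      \<in> borel_measurable (PiM I (\<lambda>_. S))"
  proof -
    \<comment> \<open>Putting the variable \<open>\<sigma> i\<close> at position \<open>i\<close> is
      a measurable map of product spaces, so \<open>U\<close> can be composed with it.\<close>
    have "(\<lambda>x. \<lambda>i\<in>{1..n}. x (\<sigma> i)) \<in> measurable (PiM I (\<lambda>_. S)) (PiM {1..n} (\<lambda>_. S))"
      by (intro measurable_restrict measurable_component_singleton \<sigma>_I)
    from measurable_compose[OF this U]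
    have "(\<lambda>x. \<Sum>J\<in>Js. H (subsample (\<lambda>i\<in>{1..n}. x (\<sigma> i)) J)) \<in> borel_measurable (PiM I (\<lambda>_. S))"
      by (simp add: Js_def)
    moreover have "subsample (\<lambda>i\<in>{1..n}. x (\<sigma> i)) J = image_mset x (image_mset \<sigma> (mset_set J))"
      if "J \<in> Js" for x :: "'i \<Rightarrow> 'z" and J
    proof -
      have "finite J" "J \<subseteq> {1..n}" using that by (auto simp: Js_def intro: finite_subset)
      then show ?thesis
        unfolding subsample_def image_mset.compositionality comp_def
        by (intro image_mset_cong) auto
    qed
    ultimately show ?thesis by (simp cong: sum.cong)
  qed
  \<comment> \<open>These index sets select exactly \<open>M\<close>. The first \<open>m\<close>
    positions form one of them, so the coefficient of the wanted kernel value is positive.\<close>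
  define Jeq where "Jeq = {J \<in> Js. image_mset \<sigma> (mset_set J) = M}"
  have finJeq: "finite Jeq" using finJs by (simp add: Jeq_def)
  have "{1..m} \<in> Jeq"
    using image_\<sigma>[OF mn] mn len ms by (simp add: Jeq_def Js_def xs_def)
  then have card_pos: "card Jeq > 0" using finJeq by (auto simp: card_gt_0_iff)
  have rest: "(\<lambda>x. H (image_mset x (image_mset \<sigma> (mset_set J)))) \<in> borel_measurable (PiM I (\<lambda>_. S))"
    if "J \<in> Js - Jeq" for J
  proof -
    let ?L = "image_mset \<sigma> (mset_set J)"
    let ?other = "filter_mset (\<lambda>i. i \<noteq> i0)"
    have J: "finite J" "J \<subseteq> {1..n}" "card J = m"
      using that by (auto simp: Js_def intro: finite_subset)
    have L: "set_mset ?L \<subseteq> I" "size ?L = m"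
      using J \<sigma>_I by auto
    have "?L \<subseteq># image_mset \<sigma> (mset_set {1..n})"
      using J by (intro image_mset_subseteq_mono) (simp add: subset_imp_msubset_mset_set)
    also have "\<dots> = mset xs" using len_xs image_\<sigma>[of n] by simp
    finally have sub: "?other ?L \<subseteq># ?other (mset xs)"
      by (rule multiset_filter_mono)
    also have "?other (mset xs) = ?other M"
      by (simp add: xs_def ms)
    finally have sub: "?other ?L \<subseteq># ?other M" .
    \<comment> \<open>For fixed size \<open>m\<close>, the entries other than \<open>i0\<close>
      determine the whole multiset. An index set outside \<open>Jeq\<close> therefore selects
      strictly fewer such entries than \<open>M\<close> has, and the induction hypothesis
      applies.\<close>
    have split: "N = ?other N + replicate_mset (m - size (?other N)) i0"
      if "size N = m" for N
    proof -
      have N: "N = ?other N + filter_mset (\<lambda>i. i = i0) N"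
        by (metis (full_types) multiset_partition union_commute)
      then have "size N = size (?other N) + size (filter_mset (\<lambda>i. i = i0) N)"
        by (metis size_union)
      then show ?thesis
        using N that by (simp add: filter_eq_replicate_mset)
    qed
    have "?other ?L \<noteq> ?other M"
    proof
      assume "?other ?L = ?other M"
      then have "?L = M"
        using split L(2) less.prems(2) by metis
      then show False using that by (simp add: Jeq_def)
    qed
    with sub have "size (?other ?L) < size (?other M)"
      by (intro mset_subset_size) (simp add: subset_mset.less_le)
    then show ?thesis
      using L by (rule less.hyps)
  qed
  \<comment> \<open>All terms over \<open>Jeq\<close> coincide, so the kernel value at
    \<open>M\<close> can be solved for.\<close>
  have "H (image_mset x M) =
      ((\<Sum>J\<in>Js. H (image_mset x (image_mset \<sigma> (mset_set J)))) -
       (\<Sum>J\<in>Js - Jeq. H (image_mset x (image_mset \<sigma> (mset_set J))))) / real (card Jeq)" for x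
  proof -
    have "(\<Sum>J\<in>Js. H (image_mset x (image_mset \<sigma> (mset_set J)))) =
        (\<Sum>J\<in>Js - Jeq. H (image_mset x (image_mset \<sigma> (mset_set J)))) +
        (\<Sum>J\<in>Jeq. H (image_mset x (image_mset \<sigma> (mset_set J))))"
      using finJs by (intro sum.subset_diff) (auto simp: Jeq_def)
    also have "(\<Sum>J\<in>Jeq. H (image_mset x (image_mset \<sigma> (mset_set J)))) =
        (\<Sum>J\<in>Jeq. H (image_mset x M))"
      by (intro sum.cong refl) (simp add: Jeq_def)
    finally show ?thesis using card_pos by simp
  qed
  moreover have "(\<lambda>x. ((\<Sum>J\<in>Js. H (image_mset x (image_mset \<sigma> (mset_set J)))) -
       (\<Sum>J\<in>Js - Jeq. H (image_mset x (image_mset \<sigma> (mset_set J))))) / real (card Jeq))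
      \<in> borel_measurable (PiM I (\<lambda>_. S))"
    by (intro borel_measurable_divide borel_measurable_diff sum_meas borel_measurable_sum rest
        borel_measurable_const)
  ultimately show ?case by simp
qed

theorem theorem2p1:
  fixes X :: "(real ^ 'd) set"
    and A :: "((real ^ 'd) \<times> bool) multiset \<Rightarrow> real ^ 'd \<Rightarrow> bool"
    and P :: "'w measure" and Q :: "((real ^ 'd) \<times> bool) measure"
    and Z :: "nat \<Rightarrow> 'w \<Rightarrow> (real ^ 'd) \<times> bool"
    and n p m :: nat
  assumes rule: "classification_rule X A"
    and sample: "iid_sample P (obs_space X) Q n Z"
    and p: "1 \<le> p" "p \<le> n - 1"
    and wd: "lpo_well_defined X A p n"
    and m: "m = n - p + 1"
  shows "is_U_statistic (obs_space X) n m (lpo_kernel A m) (lpo_risk A p n) \<and>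
    (\<forall>\<omega> \<in> space P. lpo_risk A p n (\<lambda>i. Z i \<omega>) = U_stat n m (lpo_kernel A m) (\<lambda>i. Z i \<omega>))"
proof -
  have mn: "m \<le> n" "1 \<le> m" and pn: "p \<le> n" using p m by auto
  have U: "U_stat n m (lpo_kernel A m) z =
      (\<Sum>J | J \<subseteq> {1..n} \<and> card J = m. lpo_mset_kernel A m (subsample z J)) / real (n choose m)" for z
    by (intro U_stat_eq_sum_subsets lpo_kernel_eq_mset_kernel)
  have eq: "lpo_risk A p n z = U_stat n m (lpo_kernel A m) z" for z
    unfolding U by (rule lpo_risk_eq_sum_subsets[OF p(1) pn m])
  \<comment> \<open>Clearing the denominator is legitimate because \<open>m \<le> n\<close> makes
    the binomial coefficient nonzero.\<close>
  have "(\<lambda>z. \<Sum>J | J \<subseteq> {1..n} \<and> card J = m. lpo_mset_kernel A m (subsample z J)) =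
      (\<lambda>z. real (n choose m) * lpo_risk A p n z)"
    using mn by (simp add: eq U)
  also have "\<dots> \<in> borel_measurable (PiM {1..n} (\<lambda>_. obs_space X))"
    using wd by (simp add: lpo_well_defined_def)
  finally have "(\<lambda>x. lpo_mset_kernel A m (image_mset x (mset_set {1..m})))
      \<in> borel_measurable (PiM {1..m} (\<lambda>_. obs_space X))"
    \<comment> \<open>Here each of the variables \<open>1, ..., m\<close> occurs once; the variable
      1, available since \<open>1 \<le> m\<close>, serves for padding.\<close>
    using mn by (intro measurable_kernel_of_measurable_U_sum[where ?i0.0 = 1]) auto
  moreover have "lpo_kernel A m (map x [1..<Suc m]) =
      lpo_mset_kernel A m (image_mset x (mset_set {1..m}))" for x
    by (simp add: lpo_kernel_eq_mset_kernel atLeastLessThanSuc_atLeastAtMost del: upt_Suc)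
  moreover have "lpo_kernel A m zs' = lpo_kernel A m zs"
    if "length zs = m" "mset zs' = mset zs" for zs zs' :: "((real ^ 'd) \<times> bool) list"
    using that by (metis lpo_kernel_eq_mset_kernel mset_eq_length)
  ultimately have "U_kernel (obs_space X) m (lpo_kernel A m)"
    by (simp add: U_kernel_def del: upt_Suc)
  then show ?thesis
    using mn eq by (simp add: is_U_statistic_def)
qed

end
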